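(* Let $\theta\in\{\cup,\triangleright,\otimes\}$, and let $\succ$ and $\succ_0$ be preference relations over a relation schema $R$. For an instance $r$ of $R$ put \[\succ_1\,=\,TC(\succ_0\,\theta\,\succ),\quad \succ_2\,=\,[TC(\succ_0\,\theta\,\succ)]_r,\quad \succ_3\,=\,TC([\succ_0\,\theta\,\succ]_r),\quad \succ_4\,=\,TC([\succ_0]_r\,\theta\,[\succ]_r).\] Then for every instance $r$ of $R$: \[\succ_4\ =\ \succ_3\ \subseteq\ \succ_2\ \subseteq\ \succ_1.\] Moreover, there are cases (preference relations $\succ,\succ_0$ and a relation instance $r$) for which both containments are strict.
   Context: A relation schema $R$ determines a set $U$ of all possible tuples (a product of attribute domains, each a countably infinite set of constants or $\mathbb{Q}$). An instance of $R$ is a finite set of tuples from $U$. A preference relation over $R$ is any subset of $U\times U$ (possibly infinite). The restriction of $\succ$ to $r$ is the preference relation $[\succ]_r\,=\,\succ\cap\,(r\times r)$. $TC(\cdot)$ denotes transitive closure (chains of length $\ge 1$). Composition operators: union $\succ_1\cup\succ_2$ is set union; prioritized composition: $t_1(\succ_1\triangleright\succ_2)t_2$ iff $t_1\succ_1 t_2\vee(t_2\not\succ_1 t_1\wedge t_1\succ_2 t_2)$; Pareto composition: $t_1(\succ_1\otimes\succ_2)t_2$ iff $(t_1\succ_1 t_2\wedge t_2\not\succ_2 t_1)\vee(t_1\succ_2 t_2\wedge t_2\not\succ_1 t_1)$ (here $\succ_1,\succ_2$ are generic names for the arguments of the operators). *)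

theory Defs
  imports Complex_Main "HOL-Library.FuncSet" "HOL-Library.Countable_Set"
begin

datatype 'c attr_value = Const 'c | Rational rat

definition attribute_domain :: "'c attr_value set \<Rightarrow> bool" where
  "attribute_domain D \<longleftrightarrow>
     (\<exists>C. countable C \<and> infinite C \<and> D = Const ` C) \<or> D = range Rational"

record ('a, 'c) rel_schema =
  attributes :: "'a set"
  attr_domain :: "'a \<Rightarrow> 'c attr_value set"

definition relation_schema :: "('a, 'c) rel_schema \<Rightarrow> bool" where
  "relation_schema R \<longleftrightarrow>
     finite (attributes R) \<and> attributes R \<noteq> {} \<and>
     (\<forall>A\<in>attributes R. attribute_domain (attr_domain R A))"

text \<open>A tuple maps each attribute to a value of its domain; it is extensional
  (\<^const>\<open>undefined\<close> outside the attribute set), so that equality of tuples is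
  agreement on all attributes.\<close>

definition tuples :: "('a, 'c) rel_schema \<Rightarrow> ('a \<Rightarrow> 'c attr_value) set" where
  "tuples R = (\<Pi>\<^sub>E A\<in>attributes R. attr_domain R A)"

definition relation_instance ::
  "('a, 'c) rel_schema \<Rightarrow> ('a \<Rightarrow> 'c attr_value) set \<Rightarrow> bool" where
  "relation_instance R r \<longleftrightarrow> finite r \<and> r \<subseteq> tuples R"

definition preference_relation ::
  "('a, 'c) rel_schema \<Rightarrow> ('a \<Rightarrow> 'c attr_value) rel \<Rightarrow> bool" where
  "preference_relation R P \<longleftrightarrow> P \<subseteq> tuples R \<times> tuples R"

definition restriction :: "'t rel \<Rightarrow> 't set \<Rightarrow> 't rel" where
  "restriction P r = P \<inter> (r \<times> r)"

definition prioritized :: "'t rel \<Rightarrow> 't rel \<Rightarrow> 't rel" where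
  "prioritized P Q = {(s, t). (s, t) \<in> P \<or> ((t, s) \<notin> P \<and> (s, t) \<in> Q)}"

definition pareto :: "'t rel \<Rightarrow> 't rel \<Rightarrow> 't rel" where
  "pareto P Q =
     {(s, t). ((s, t) \<in> P \<and> (t, s) \<notin> Q) \<or> ((s, t) \<in> Q \<and> (t, s) \<notin> P)}"

end

theory Submission
  imports Defs "HOL-Library.Equipollence"
begin

text \<open>Each of the three operators decides a pair \<open>(s, t)\<close> only from the
  membership of \<open>(s, t)\<close> and \<open>(t, s)\<close> in its arguments. Since
  \<open>r \<times> r\<close> is symmetric, composition therefore commutes with restriction
  (\<open>restriction_composition\<close>), which gives the equality. The inclusions hold because a
  chain inside \<open>r\<close> is a chain with both ends in \<open>r\<close>
  (\<open>trancl_restriction_subset\<close>). They are strict when a chain between two tuples of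
  \<open>r\<close> passes through a tuple outside \<open>r\<close>
  (\<open>trancl_restriction_strict\<close>); infinite domains provide the tuples.\<close>

lemma infinite_attribute_domain:
  assumes "attribute_domain D"
  shows "infinite D"
  using assms
  by (auto simp: attribute_domain_def finite_image_iff inj_on_def infinite_UNIV_char_0)

lemma infinite_tuples:
  assumes "relation_schema R"
  shows "infinite (tuples R)"
proof -
  have dom: "infinite (attr_domain R A)" if "A \<in> attributes R" for A
    using assms that by (simp add: relation_schema_def infinite_attribute_domain)
  moreover have "attributes R \<noteq> {}"
    using assms by (simp add: relation_schema_def)
  \<comment> \<open>An empty product would be finite whatever its factors; once it is nonempty, a
    single infinite factor makes it infinite.\<close>
  moreover have "tuples R \<noteq> {}"
    unfolding tuples_def PiE_eq_empty_iff using dom by fastforce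
  ultimately show ?thesis
    unfolding tuples_def finite_PiE_iff by blast
qed

lemma restriction_composition:
  assumes "\<theta> \<in> {(\<union>), prioritized, pareto}"
  shows "\<theta> (restriction P r) (restriction Q r) = restriction (\<theta> P Q) r"
  using assms by (auto simp: restriction_def prioritized_def pareto_def)

text \<open>With an empty first argument nothing can override a pair of \<open>P\<close>, so a
  single counterexample relation serves all three operators.\<close>

lemma empty_composition:
  assumes "\<theta> \<in> {(\<union>), prioritized, pareto}"
  shows "\<theta> {} P = P"
  using assms by (auto simp: prioritized_def pareto_def)

text \<open>A chain of restricted steps is a chain of \<open>P\<close> that never leaves
  \<open>r\<close>, whereas the right-hand side constrains only its endpoints.\<close>

lemma trancl_restriction_subset: "(restriction P r)\<^sup>+ \<subseteq> restriction (P\<^sup>+) r"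
proof -
  have "(restriction P r)\<^sup>+ \<subseteq> P\<^sup>+"
    by (intro trancl_mono_subset) (simp add: restriction_def)
  moreover have "(restriction P r)\<^sup>+ \<subseteq> r \<times> r"
    by (intro trancl_subset_Sigma) (simp add: restriction_def)
  ultimately show ?thesis
    by (simp add: restriction_def)
qed

text \<open>A two-step chain whose middle point is outside the instance.\<close>

lemma trancl_restriction_strict:
  assumes "x \<noteq> y" "y \<noteq> z" "x \<noteq> z"
  defines "P \<equiv> {(x, y), (y, z)}"
  shows "(restriction P {x, z})\<^sup>+ \<subset> restriction (P\<^sup>+) {x, z}"
    and "restriction (P\<^sup>+) {x, z} \<subset> P\<^sup>+"
proof -
  \<comment> \<open>Both edges touch \<open>y\<close>, so neither survives the restriction.\<close>
  have "restriction P {x, z} = {}"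
    using assms by (auto simp: restriction_def)
  moreover have xy: "(x, y) \<in> P\<^sup>+" and "(y, z) \<in> P\<^sup>+"
    by (auto simp: P_def)
  then have "(x, z) \<in> P\<^sup>+"
    by (rule trancl_trans)
  then have "(x, z) \<in> restriction (P\<^sup>+) {x, z}"
    by (simp add: restriction_def)
  ultimately show "(restriction P {x, z})\<^sup>+ \<subset> restriction (P\<^sup>+) {x, z}"
    by auto
  \<comment> \<open>The edge into the missing middle point witnesses the second strictness.\<close>
  have "(x, y) \<notin> restriction (P\<^sup>+) {x, z}"
    using assms by (simp add: restriction_def)
  with xy show "restriction (P\<^sup>+) {x, z} \<subset> P\<^sup>+"
    unfolding restriction_def by blast
qed

theorem theorem11:
  fixes R :: "('a, 'c) rel_schema"
    and \<theta> :: "('a \<Rightarrow> 'c attr_value) rel \<Rightarrow> ('a \<Rightarrow> 'c attr_value) rel \<Rightarrow> ('a \<Rightarrow> 'c attr_value) rel"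
  assumes "relation_schema R"
    and "\<theta> \<in> {(\<union>), prioritized, pareto}"
  shows
    "(\<forall>P P0 r. preference_relation R P \<and> preference_relation R P0 \<and> relation_instance R r \<longrightarrow>
        (\<theta> (restriction P0 r) (restriction P r))\<^sup>+ = (restriction (\<theta> P0 P) r)\<^sup>+ \<and>
        (restriction (\<theta> P0 P) r)\<^sup>+ \<subseteq> restriction ((\<theta> P0 P)\<^sup>+) r \<and>
        restriction ((\<theta> P0 P)\<^sup>+) r \<subseteq> (\<theta> P0 P)\<^sup>+) \<and>
     (\<exists>P P0 r. preference_relation R P \<and> preference_relation R P0 \<and> relation_instance R r \<and>
        (restriction (\<theta> P0 P) r)\<^sup>+ \<subset> restriction ((\<theta> P0 P)\<^sup>+) r \<and>
        restriction ((\<theta> P0 P)\<^sup>+) r \<subset> (\<theta> P0 P)\<^sup>+)"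
proof (intro conjI allI impI)
  fix P P0 :: "('a \<Rightarrow> 'c attr_value) rel" and r
  show "(\<theta> (restriction P0 r) (restriction P r))\<^sup>+ = (restriction (\<theta> P0 P) r)\<^sup>+"
    using restriction_composition[OF assms(2)] by simp
  show "(restriction (\<theta> P0 P) r)\<^sup>+ \<subseteq> restriction ((\<theta> P0 P)\<^sup>+) r"
    by (rule trancl_restriction_subset)
  show "restriction ((\<theta> P0 P)\<^sup>+) r \<subseteq> (\<theta> P0 P)\<^sup>+"
    by (simp add: restriction_def)
next
  \<comment> \<open>Three tuples suffice: two for the instance and one outside it as the middle of
    the chain.\<close>
  obtain T where "T \<subseteq> tuples R" "card T = 3"
    using infinite_arbitrarily_large[OF infinite_tuples[OF assms(1)]] by blast
  then obtain x y z where T: "{x, y, z} \<subseteq> tuples R" and distinct: "x \<noteq> y" "y \<noteq> z" "x \<noteq> z"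
    by (auto simp: card_3_iff)
  let ?P = "{(x, y), (y, z)}"
  have "preference_relation R ?P" "preference_relation R {}" "relation_instance R {x, z}"
    using T by (auto simp: preference_relation_def relation_instance_def)
  moreover have "\<theta> {} ?P = ?P"
    by (rule empty_composition[OF assms(2)])
  ultimately show "\<exists>P P0 r. preference_relation R P \<and> preference_relation R P0 \<and> relation_instance R r \<and>
        (restriction (\<theta> P0 P) r)\<^sup>+ \<subset> restriction ((\<theta> P0 P)\<^sup>+) r \<and>
        restriction ((\<theta> P0 P)\<^sup>+) r \<subset> (\<theta> P0 P)\<^sup>+"
    using trancl_restriction_strict[OF distinct] by metis
qed

end
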